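(* Let $p,q>0$ be integers, let $R=R(q,q)$, and let $G$ be a graph that is both $F_S^{p,q}$-free and $F_K^{p,q}$-free. Then $G$ has no induced subgraph isomorphic to any graph of the form $F_{p,R}$; that is, there do not exist pairwise disjoint sets $K_1,S_1,S_2,W\subseteq V(G)$ such that $K_1$ is a clique, $S_1,S_2$ are stable sets, $|K_1|=|S_1|=p$ and $K_1,S_1$ are matched, $|S_2|=|W|=R$ and $S_2,W$ are matched, $K_1$ is complete to $S_2$, and the only edges of $G[K_1\cup S_1\cup S_2\cup W]$ are those just described together with arbitrary edges between vertices of $W$.
   Context: All graphs are finite and simple. A clique is a set of pairwise adjacent vertices; a stable set is a set of pairwise non-adjacent vertices. For disjoint vertex sets $X,Y$: $X$ is complete to $Y$ if every vertex of $X$ is adjacent to every vertex of $Y$; $X$ and $Y$ are matched if every vertex of $X$ has exactly one neighbor in $Y$ and every vertex of $Y$ has exactly one neighbor in $X$. A graph $G$ is $H$-free if no induced subgraph of $G$ is isomorphic to $H$. $R(q,q)$ denotes the smallest positive integer $R$ such that every 2-coloring of the edges of the complete graph on $R$ vertices contains a monochromatic complete graph on $q$ vertices. The graph $F_S^{p,q}$ has vertex set $K\cup S_1\cup S_2\cup S_3$ (pairwise disjoint), where $K$ is a clique, $S_1,S_2,S_3$ are stable sets, $|K|=|S_1|=p$ and $K$ and $S_1$ are matched, $|S_2|=|S_3|=q$ and $S_2$ and $S_3$ are matched, $K$ is complete to $S_2$, and there are no other edges. The graph $F_K^{p,q}$ is obtained from $F_S^{p,q}$ by making all pairs of vertices of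 $S_3$ adjacent. For $a,b\in\mathbb{N}$, a graph $F_{a,b}$ has vertex set $K_1\cup S_1\cup S_2\cup W$ (pairwise disjoint), where $K_1$ is a clique, $S_1,S_2$ are stable sets, $|K_1|=|S_1|=a$ and $K_1,S_1$ are matched, $|S_2|=|W|=b$ and $S_2,W$ are matched, $K_1$ is complete to $S_2$, adjacency among pairs of vertices of $W$ is unrestricted, and there are no other edges. *)

theory Defs
  imports "Graph_Theory.Digraph_Isomorphism" "HOL-Library.Ramsey"
begin

text \<open>
  A finite simple graph is a \<open>graph\<close> in the sense of the Graph Theory library: a finite symmetric
  digraph without loops and parallel arcs. Adjacency of \<open>u\<close> and \<open>v\<close> is \<open>u \<rightarrow>\<^bsub>G\<^esub> v\<close>.
\<close>

definition clique_in :: "('a,'b) pre_digraph \<Rightarrow> 'a set \<Rightarrow> bool" where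
  "clique_in G X \<longleftrightarrow> (\<forall>u\<in>X. \<forall>v\<in>X. u \<noteq> v \<longrightarrow> u \<rightarrow>\<^bsub>G\<^esub> v)"

definition stable_in :: "('a,'b) pre_digraph \<Rightarrow> 'a set \<Rightarrow> bool" where
  "stable_in G X \<longleftrightarrow> (\<forall>u\<in>X. \<forall>v\<in>X. u \<noteq> v \<longrightarrow> \<not> u \<rightarrow>\<^bsub>G\<^esub> v)"

definition complete_to :: "('a,'b) pre_digraph \<Rightarrow> 'a set \<Rightarrow> 'a set \<Rightarrow> bool" where
  "complete_to G X Y \<longleftrightarrow> (\<forall>x\<in>X. \<forall>y\<in>Y. x \<rightarrow>\<^bsub>G\<^esub> y)"

definition matched :: "('a,'b) pre_digraph \<Rightarrow> 'a set \<Rightarrow> 'a set \<Rightarrow> bool" where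
  "matched G X Y \<longleftrightarrow>
     (\<forall>x\<in>X. \<exists>!y. y \<in> Y \<and> x \<rightarrow>\<^bsub>G\<^esub> y) \<and> (\<forall>y\<in>Y. \<exists>!x. x \<in> X \<and> y \<rightarrow>\<^bsub>G\<^esub> x)"

definition free_of :: "('a,'b) pre_digraph \<Rightarrow> ('c,'d) pre_digraph \<Rightarrow> bool" where
  "free_of G H \<longleftrightarrow> \<not> (\<exists>H'. induced_subgraph H' G \<and> digraph_iso H' H)"

text \<open>The diagonal Ramsey number \<open>R(q,q)\<close>: \<open>partn_lst {..<r} [q, q] 2\<close> says that every colouring
  of the 2-element subsets of \<open>{0,\<dots>,r-1}\<close> with colours 0 and 1 has a monochromatic \<open>q\<close>-subset.\<close>

definition ramsey_diag :: "nat \<Rightarrow> nat" where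
  "ramsey_diag q = (LEAST r. 0 < r \<and> partn_lst {..<r} [q, q] 2)"

definition sym_closure :: "'a rel \<Rightarrow> 'a rel" where
  "sym_closure r = r \<union> r\<inverse>"

datatype fvert = VK nat | VS1 nat | VS2 nat | VS3 nat

definition F_S :: "nat \<Rightarrow> nat \<Rightarrow> fvert pair_pre_digraph" where
  "F_S p q = \<lparr>
     pverts = VK ` {..<p} \<union> VS1 ` {..<p} \<union> VS2 ` {..<q} \<union> VS3 ` {..<q},
     parcs = sym_closure
       ({(VK i, VK j) | i j. i < p \<and> j < p \<and> i \<noteq> j}
        \<union> {(VK i, VS1 i) | i. i < p}
        \<union> {(VS2 i, VS3 i) | i. i < q}
        \<union> {(VK i, VS2 j) | i j. i < p \<and> j < q}) \<rparr>"

definition F_K :: "nat \<Rightarrow> nat \<Rightarrow> fvert pair_pre_digraph" where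
  "F_K p q = \<lparr>
     pverts = pverts (F_S p q),
     parcs = parcs (F_S p q) \<union> {(VS3 i, VS3 j) | i j. i < q \<and> j < q \<and> i \<noteq> j} \<rparr>"

text \<open>The last conjunct is the requirement that there be no other edges; it leaves adjacency inside
  \<open>W\<close> unrestricted.\<close>

definition F_sets ::
    "('a,'b) pre_digraph \<Rightarrow> nat \<Rightarrow> nat \<Rightarrow> 'a set \<Rightarrow> 'a set \<Rightarrow> 'a set \<Rightarrow> 'a set \<Rightarrow> bool" where
  "F_sets G a b K1 S1 S2 W \<longleftrightarrow>
     K1 \<inter> S1 = {} \<and> K1 \<inter> S2 = {} \<and> K1 \<inter> W = {} \<and> S1 \<inter> S2 = {} \<and> S1 \<inter> W = {} \<and> S2 \<inter> W = {} \<and>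
     clique_in G K1 \<and> stable_in G S1 \<and> stable_in G S2 \<and>
     card K1 = a \<and> card S1 = a \<and> matched G K1 S1 \<and>
     card S2 = b \<and> card W = b \<and> matched G S2 W \<and>
     complete_to G K1 S2 \<and>
     (\<forall>u \<in> K1 \<union> S1 \<union> S2 \<union> W. \<forall>v \<in> K1 \<union> S1 \<union> S2 \<union> W. u \<rightarrow>\<^bsub>G\<^esub> v \<longrightarrow>
        (u, v) \<in> sym_closure (K1 \<times> K1 \<union> K1 \<times> S1 \<union> S2 \<times> W \<union> K1 \<times> S2 \<union> W \<times> W))"

definition F_form :: "nat \<Rightarrow> nat \<Rightarrow> ('a,'b) pre_digraph \<Rightarrow> bool" where
  "F_form a b H \<longleftrightarrow> graph H \<and>
     (\<exists>K1 S1 S2 W. verts H = K1 \<union> S1 \<union> S2 \<union> W \<and> F_sets H a b K1 S1 S2 W)"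

lemma ramsey_diag:
  shows "0 < ramsey_diag q" and "partn_lst {..<ramsey_diag q} [q, q] 2"
proof -
  obtain N where N: "partn_lst {..<N::nat} [q, q] 2"
    using ramsey2_full by blast
  have "partn_lst {..<Suc N} [q, q] 2"
    by (rule partn_lst_greater_resource[OF N]) auto
  then have "\<exists>r::nat. 0 < r \<and> partn_lst {..<r} [q, q] 2" by blast
  then have "0 < ramsey_diag q \<and> partn_lst {..<ramsey_diag q} [q, q] 2"
    unfolding ramsey_diag_def by (rule LeastI_ex)
  then show "0 < ramsey_diag q" and "partn_lst {..<ramsey_diag q} [q, q] 2" by blast+
qed

lemma arcs_F_S:
  "(u, v) \<in> parcs (F_S p q) \<longleftrightarrow> (case (u, v) of
     (VK i, VK j) \<Rightarrow> i < p \<and> j < p \<and> i \<noteq> j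
   | (VK i, VS1 j) \<Rightarrow> i < p \<and> i = j | (VS1 i, VK j) \<Rightarrow> i < p \<and> i = j
   | (VS2 i, VS3 j) \<Rightarrow> i < q \<and> i = j | (VS3 i, VS2 j) \<Rightarrow> i < q \<and> i = j
   | (VK i, VS2 j) \<Rightarrow> i < p \<and> j < q | (VS2 i, VK j) \<Rightarrow> i < q \<and> j < p
   | _ \<Rightarrow> False)"
  by (cases u; cases v) (auto simp: F_S_def sym_closure_def)

lemma arcs_F_K:
  "(u, v) \<in> parcs (F_K p q) \<longleftrightarrow> (u, v) \<in> parcs (F_S p q) \<or>
     (case (u, v) of (VS3 i, VS3 j) \<Rightarrow> i < q \<and> j < q \<and> i \<noteq> j | _ \<Rightarrow> False)"
  by (cases u; cases v) (auto simp: F_K_def)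

lemma graph_F_S: "graph (F_S p q)"
proof -
  let ?V = "pverts (F_S p q)"
  have fin: "finite ?V" by (simp add: F_S_def)
  have sub: "parcs (F_S p q) \<subseteq> ?V \<times> ?V" by (auto simp: F_S_def sym_closure_def)
  then have "finite (parcs (F_S p q))" using fin by (meson finite_SigmaI finite_subset)
  then have "pair_graph (F_S p q)"
    using fin sub
    by unfold_locales (auto simp: symmetric_def sym_def arcs_F_S split: fvert.splits)
  then show ?thesis by (rule pair_graph.pair_graphD_graph)
qed

lemma graph_F_K: "graph (F_K p q)"
proof -
  let ?V = "pverts (F_K p q)"
  have fin: "finite ?V" by (simp add: F_K_def F_S_def)
  have sub: "parcs (F_K p q) \<subseteq> ?V \<times> ?V" by (auto simp: F_K_def F_S_def sym_closure_def)
  then have "finite (parcs (F_K p q))" using fin by (meson finite_SigmaI finite_subset)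
  then have "pair_graph (F_K p q)"
    using fin sub
    by unfold_locales (auto simp: symmetric_def sym_def arcs_F_K arcs_F_S split: fvert.splits)
  then show ?thesis by (rule pair_graph.pair_graphD_graph)
qed

lemma F_S_sets:
  "F_sets (F_S p q) p q (VK ` {..<p}) (VS1 ` {..<p}) (VS2 ` {..<q}) (VS3 ` {..<q})"
  "stable_in (F_S p q) (VS3 ` {..<q})"
proof -
  show "stable_in (F_S p q) (VS3 ` {..<q})" by (auto simp: stable_in_def arcs_F_S)
  have "clique_in (F_S p q) (VK ` {..<p})" by (auto simp: clique_in_def arcs_F_S)
  moreover have "stable_in (F_S p q) (VS1 ` {..<p})" "stable_in (F_S p q) (VS2 ` {..<q})"
    by (auto simp: stable_in_def arcs_F_S)
  moreover have "matched (F_S p q) (VK ` {..<p}) (VS1 ` {..<p})"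
    "matched (F_S p q) (VS2 ` {..<q}) (VS3 ` {..<q})"
    by (auto simp: matched_def arcs_F_S)
  moreover have "complete_to (F_S p q) (VK ` {..<p}) (VS2 ` {..<q})"
    by (auto simp: complete_to_def arcs_F_S)
  moreover have "u \<rightarrow>\<^bsub>F_S p q\<^esub> v \<Longrightarrow>
      (u, v) \<in> sym_closure (VK ` {..<p} \<times> VK ` {..<p} \<union> VK ` {..<p} \<times> VS1 ` {..<p} \<union>
        VS2 ` {..<q} \<times> VS3 ` {..<q} \<union> VK ` {..<p} \<times> VS2 ` {..<q} \<union>
        VS3 ` {..<q} \<times> VS3 ` {..<q})" for u v
    by (cases u; cases v) (auto simp: sym_closure_def arcs_F_S)
  moreover have "card (VK ` {..<p}) = p" "card (VS1 ` {..<p}) = p"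
    "card (VS2 ` {..<q}) = q" "card (VS3 ` {..<q}) = q"
    by (auto simp: card_image inj_on_def)
  ultimately show "F_sets (F_S p q) p q (VK ` {..<p}) (VS1 ` {..<p}) (VS2 ` {..<q}) (VS3 ` {..<q})"
    unfolding F_sets_def by (intro conjI ballI impI) (blast | assumption)+
qed

lemma F_K_sets:
  "F_sets (F_K p q) p q (VK ` {..<p}) (VS1 ` {..<p}) (VS2 ` {..<q}) (VS3 ` {..<q})"
  "clique_in (F_K p q) (VS3 ` {..<q})"
proof -
  show "clique_in (F_K p q) (VS3 ` {..<q})" by (auto simp: clique_in_def arcs_F_K arcs_F_S)
  have "clique_in (F_K p q) (VK ` {..<p})" by (auto simp: clique_in_def arcs_F_K arcs_F_S)
  moreover have "stable_in (F_K p q) (VS1 ` {..<p})" "stable_in (F_K p q) (VS2 ` {..<q})"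
    by (auto simp: stable_in_def arcs_F_K arcs_F_S)
  moreover have "matched (F_K p q) (VK ` {..<p}) (VS1 ` {..<p})"
    "matched (F_K p q) (VS2 ` {..<q}) (VS3 ` {..<q})"
    by (auto simp: matched_def arcs_F_K arcs_F_S)
  moreover have "complete_to (F_K p q) (VK ` {..<p}) (VS2 ` {..<q})"
    by (auto simp: complete_to_def arcs_F_K arcs_F_S)
  moreover have "u \<rightarrow>\<^bsub>F_K p q\<^esub> v \<Longrightarrow>
      (u, v) \<in> sym_closure (VK ` {..<p} \<times> VK ` {..<p} \<union> VK ` {..<p} \<times> VS1 ` {..<p} \<union>
        VS2 ` {..<q} \<times> VS3 ` {..<q} \<union> VK ` {..<p} \<times> VS2 ` {..<q} \<union>
        VS3 ` {..<q} \<times> VS3 ` {..<q})" for u v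
    by (cases u; cases v) (auto simp: sym_closure_def arcs_F_K arcs_F_S)
  moreover have "card (VK ` {..<p}) = p" "card (VS1 ` {..<p}) = p"
    "card (VS2 ` {..<q}) = q" "card (VS3 ` {..<q}) = q"
    by (auto simp: card_image inj_on_def)
  ultimately show "F_sets (F_K p q) p q (VK ` {..<p}) (VS1 ` {..<p}) (VS2 ` {..<q}) (VS3 ` {..<q})"
    unfolding F_sets_def by (intro conjI ballI impI) (blast | assumption)+
qed

end

theory Submission
  imports Defs
begin

text \<open>
  Colour the pairs of \<open>W\<close> by adjacency. As \<open>|W| = R(q,q)\<close>, some \<open>q\<close>-subset \<open>X\<close> of \<open>W\<close> is a clique or
  a stable set, and \<open>K\<^sub>1\<close>, \<open>S\<^sub>1\<close>, \<open>X\<close> together with the partners of \<open>X\<close> in \<open>S\<^sub>2\<close> induce a copy of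
  \<open>F_K p q\<close> or of \<open>F_S p q\<close>. An induced copy of a graph of the form \<open>F_{p,R}\<close> yields such sets in
  \<open>G\<close> by pulling back along the isomorphism.
\<close>

section \<open>Induced copies obtained from embeddings\<close>

text \<open>The inverse of \<open>f\<close> carries the subgraph of \<open>G\<close> induced on the
  image of \<open>f\<close> to \<open>P\<close>. Since \<open>digraph_iso\<close> compares whole
  digraphs, arcs must be carried along too, each arc going to the pair of preimages of its
  ends.\<close>

lemma not_free_of_if_embedding:
  fixes P :: "'c pair_pre_digraph"
  assumes "graph G"
    and wf: "parcs P \<subseteq> pverts P \<times> pverts P"
    and inj: "inj_on f (pverts P)" and sub: "f ` pverts P \<subseteq> verts G"
    and adj: "\<And>u v. u \<in> pverts P \<Longrightarrow> v \<in> pverts P \<Longrightarrow> f u \<rightarrow>\<^bsub>G\<^esub> f v \<longleftrightarrow> (u, v) \<in> parcs P"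
  shows "\<not> free_of G P"
proof -
  interpret graph G by fact
  let ?H = "G \<restriction> (f ` pverts P)"
  define g where "g = the_inv_into (pverts P) f"
  have gf: "g (f u) = u" if "u \<in> pverts P" for u
    using that inj by (simp add: g_def the_inv_into_f_f)
  \<comment> \<open>The arcs of \<open>with_proj P\<close> are pairs with ends \<open>fst\<close>
    and \<open>snd\<close>, which fixes the last three fields.\<close>
  define h :: "('a, 'b, 'c, 'c \<times> 'c) digraph_isomorphism" where
    "h = \<lparr> iso_verts = g, iso_arcs = (\<lambda>e. (g (tail G e), g (head G e))), iso_head = snd, iso_tail = fst \<rparr>"
  have ind: "induced_subgraph ?H G"
    using sub by (rule induced_induce)
  have "inj_on g (f ` pverts P)"
    by (auto simp: inj_on_def gf)
  \<comment> \<open>Two arcs with the same image have the same ends, because \<open>g\<close> is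
    injective on the image of \<open>f\<close>; without parallel arcs they coincide.\<close>
  moreover have "inj_on (\<lambda>e. (g (tail G e), g (head G e))) (arcs ?H)"
    by (rule inj_onI, rule no_multi_arcs) (auto simp: arc_to_ends_def gf)
  moreover have "wf_digraph ?H"
    by (rule wellformed_induce_subgraph)
  ultimately have iso: "pre_digraph.digraph_isomorphism ?H h"
    by (simp add: pre_digraph.digraph_isomorphism_def h_def)
  have "g ` f ` pverts P = pverts P"
    by (force simp: gf)
  moreover have "(\<lambda>e. (g (tail G e), g (head G e))) ` arcs ?H = parcs P" (is "?L = _")
  proof
    show "?L \<subseteq> parcs P"
    proof
      fix x assume "x \<in> ?L"
      then obtain e u v where e: "e \<in> arcs G" "tail G e = f u" "head G e = f v"
        "u \<in> pverts P" "v \<in> pverts P" "x = (g (tail G e), g (head G e))"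
        by auto
      then have "f u \<rightarrow>\<^bsub>G\<^esub> f v" by (force simp: arcs_ends_conv)
      with e show "x \<in> parcs P" by (simp add: gf adj)
    qed
    show "parcs P \<subseteq> ?L"
    proof
      fix x assume x: "x \<in> parcs P"
      \<comment> \<open>\<open>wf\<close> puts the ends of the pair among the vertices of
        \<open>P\<close>, the only place where \<open>adj\<close> gives information.\<close>
      then obtain u v where uv: "x = (u, v)" "u \<in> pverts P" "v \<in> pverts P"
        using wf by auto
      with x have "f u \<rightarrow>\<^bsub>G\<^esub> f v" by (simp add: adj)
      then obtain e where "e \<in> arcs G" "tail G e = f u" "head G e = f v"
        by (auto simp: arcs_ends_conv)
      with uv show "x \<in> ?L" by (auto simp: gf intro!: rev_image_eqI[of e])
    qed
  qed
  ultimately have "with_proj P = app_iso h ?H"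
    by (simp add: with_proj_def app_iso_def h_def)
  with ind iso show ?thesis
    unfolding free_of_def digraph_iso_def by blast
qed

section \<open>Matchings and the structure shared by \<open>F_S\<close> and
  \<open>F_K\<close>\<close>

text \<open>Let \<open>m\<close> send \<open>y\<close> to its neighbour in \<open>X\<close>.
  Uniqueness of that neighbour yields the adjacency rule, uniqueness of neighbours in
  \<open>Y\<close> makes \<open>m\<close> injective, and their existence makes it
  surjective.\<close>

lemma matched_bij_betw:
  assumes "symmetric G" and "matched G X Y"
  obtains m where "bij_betw m Y X"
    and "\<And>x y. x \<in> X \<Longrightarrow> y \<in> Y \<Longrightarrow> x \<rightarrow>\<^bsub>G\<^esub> y \<longleftrightarrow> x = m y"
proof -
  have sym: "u \<rightarrow>\<^bsub>G\<^esub> v \<longleftrightarrow> v \<rightarrow>\<^bsub>G\<^esub> u" for u v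
    using assms(1) by (meson arcs_ends_symmetric)
  have "\<forall>y\<in>Y. \<exists>x. x \<in> X \<and> y \<rightarrow>\<^bsub>G\<^esub> x"
    using assms(2) by (auto simp: matched_def)
  then obtain m where m: "\<And>y. y \<in> Y \<Longrightarrow> m y \<in> X \<and> y \<rightarrow>\<^bsub>G\<^esub> m y"
    by metis
  have adj: "x \<rightarrow>\<^bsub>G\<^esub> y \<longleftrightarrow> x = m y" if "x \<in> X" "y \<in> Y" for x y
    using that m assms(2) sym unfolding matched_def by metis
  moreover have "bij_betw m Y X"
  proof (rule bij_betw_imageI)
    show "inj_on m Y"
      using m adj assms(2) unfolding matched_def inj_on_def by metis
    show "m ` Y = X"
      using m adj assms(2) unfolding matched_def by (auto simp: image_iff) metis
  qed
  ultimately show ?thesis by (rule that[rotated])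
qed

text \<open>Every adjacency among \<open>K1\<close>, \<open>S1\<close>, \<open>X\<close> and the
  partners of \<open>X\<close> in \<open>S2\<close> is forced, except inside \<open>X\<close>.
  Leaving out the pairs of \<open>VS3\<close> vertices lets one map serve for both
  \<open>F_S\<close> and \<open>F_K\<close>.\<close>

lemma F_sets_embedding:
  assumes "graph G" and F: "F_sets G p b K1 S1 S2 W"
    and V: "K1 \<subseteq> verts G" "S1 \<subseteq> verts G" "S2 \<subseteq> verts G" "W \<subseteq> verts G"
    and X: "X \<subseteq> W" "card X = q"
  obtains f where "inj_on f (pverts (F_S p q))" and "f ` pverts (F_S p q) \<subseteq> verts G"
    and "\<And>i. i < q \<Longrightarrow> f (VS3 i) \<in> X"
    and "\<And>u v. u \<in> pverts (F_S p q) \<Longrightarrow> v \<in> pverts (F_S p q) \<Longrightarrow>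
      \<not> (u \<in> range VS3 \<and> v \<in> range VS3) \<Longrightarrow> f u \<rightarrow>\<^bsub>G\<^esub> f v \<longleftrightarrow> (u, v) \<in> parcs (F_S p q)"
proof -
  interpret graph G by fact
  note F = F[unfolded F_sets_def]
  have sym: "u \<rightarrow>\<^bsub>G\<^esub> v \<longleftrightarrow> v \<rightarrow>\<^bsub>G\<^esub> u" for u v
    using sym_arcs by (meson arcs_ends_symmetric)
  have irrefl: "\<not> u \<rightarrow>\<^bsub>G\<^esub> u" for u
    using no_loops by (auto simp: arcs_ends_conv)
  have fin: "finite S1" "finite X"
    using V X finite_verts by (meson finite_subset)+
  have "matched G K1 S1" "matched G S2 W"
    using F by blast+
  obtain m where m: "bij_betw m S1 K1"
    and m_adj: "\<And>x y. x \<in> K1 \<Longrightarrow> y \<in> S1 \<Longrightarrow> x \<rightarrow>\<^bsub>G\<^esub> y \<longleftrightarrow> x = m y"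
    using matched_bij_betw[OF sym_arcs \<open>matched G K1 S1\<close>] by blast
  obtain n where n: "bij_betw n W S2"
    and n_adj: "\<And>x y. x \<in> S2 \<Longrightarrow> y \<in> W \<Longrightarrow> x \<rightarrow>\<^bsub>G\<^esub> y \<longleftrightarrow> x = n y"
    using matched_bij_betw[OF sym_arcs \<open>matched G S2 W\<close>] by blast
  \<comment> \<open>Only \<open>S1\<close> and \<open>X\<close> are numbered. The vertices of
    \<open>K1\<close> and the partners of \<open>X\<close> inherit their indices through
    \<open>m\<close> and \<open>n\<close>, so that being matched becomes equality of
    indices.\<close>
  obtain s where s: "bij_betw s {..<p} S1"
    using ex_bij_betw_nat_finite[OF fin(1)] F by (auto simp: atLeast0LessThan)
  obtain w where w: "bij_betw w {..<q} X"
    using ex_bij_betw_nat_finite[OF fin(2)] X by (auto simp: atLeast0LessThan)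
  have s_in: "s i \<in> S1" "m (s i) \<in> K1" if "i < p" for i
    using that s m by (auto simp: bij_betw_def)
  have w_in: "w i \<in> X" "w i \<in> W" "n (w i) \<in> S2" if "i < q" for i
    using that w n X by (auto simp: bij_betw_def)
  have s_eq: "s i = s j \<longleftrightarrow> i = j" "m (s i) = m (s j) \<longleftrightarrow> i = j" if "i < p" "j < p" for i j
    using that s m s_in by (auto simp: bij_betw_def inj_on_eq_iff)
  have w_eq: "w i = w j \<longleftrightarrow> i = j" "n (w i) = n (w j) \<longleftrightarrow> i = j" if "i < q" "j < q" for i j
    using that w n w_in by (auto simp: bij_betw_def inj_on_eq_iff)
  define f where "f = case_fvert (\<lambda>i. m (s i)) s (\<lambda>i. n (w i)) w"
  have f_simps [simp]: "f (VK i) = m (s i)" "f (VS1 i) = s i" "f (VS2 i) = n (w i)" "f (VS3 i) = w i" for i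
    by (auto simp: f_def)
  have disj: "\<And>x. x \<in> K1 \<Longrightarrow> x \<notin> S1 \<and> x \<notin> S2 \<and> x \<notin> W" "\<And>x. x \<in> S1 \<Longrightarrow> x \<notin> S2 \<and> x \<notin> W"
    "\<And>x. x \<in> S2 \<Longrightarrow> x \<notin> W"
    using F by blast+
  \<comment> \<open>These are the pairs that the last conjunct of \<open>F_sets\<close> rules out:
    by disjointness they lie in none of the listed products, in either order.\<close>
  have no: "\<not> x \<rightarrow>\<^bsub>G\<^esub> y" if "x \<in> K1 \<and> y \<in> W \<or> x \<in> S1 \<and> y \<in> S2 \<or> x \<in> S1 \<and> y \<in> W" for x y
  proof
    assume "x \<rightarrow>\<^bsub>G\<^esub> y"
    moreover have "x \<in> K1 \<union> S1 \<union> S2 \<union> W" "y \<in> K1 \<union> S1 \<union> S2 \<union> W" using that by auto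
    ultimately have "(x, y) \<in> sym_closure (K1 \<times> K1 \<union> K1 \<times> S1 \<union> S2 \<times> W \<union> K1 \<times> S2 \<union> W \<times> W)"
      using F by blast
    then show False using that disj by (auto simp: sym_closure_def)
  qed
  have KK: "x \<rightarrow>\<^bsub>G\<^esub> y \<longleftrightarrow> x \<noteq> y" if "x \<in> K1" "y \<in> K1" for x y
    using that F irrefl by (auto simp: clique_in_def)
  have SS: "\<not> x \<rightarrow>\<^bsub>G\<^esub> y" if "x \<in> S1 \<and> y \<in> S1 \<or> x \<in> S2 \<and> y \<in> S2" for x y
  proof -
    have "stable_in G S1" "stable_in G S2" using F by blast+
    with that irrefl show ?thesis unfolding stable_in_def by metis
  qed
  have KS: "x \<rightarrow>\<^bsub>G\<^esub> y" if "x \<in> K1" "y \<in> S2" for x y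
    using that F by (auto simp: complete_to_def)
  have verts_cases: "(\<exists>i<p. u = VK i) \<or> (\<exists>i<p. u = VS1 i) \<or> (\<exists>i<q. u = VS2 i) \<or> (\<exists>i<q. u = VS3 i)"
    if "u \<in> pverts (F_S p q)" for u
    using that by (auto simp: F_S_def)
  \<comment> \<open>Vertices of the same kind are separated by their indices, vertices of different
    kinds by the disjointness of the four sets.\<close>
  have "f u = f v \<longleftrightarrow> u = v" if "u \<in> pverts (F_S p q)" "v \<in> pverts (F_S p q)" for u v
    using verts_cases[OF that(1)] verts_cases[OF that(2)]
    by (elim disjE exE conjE; simp add: s_eq w_eq; metis disj s_in w_in)
  then have "inj_on f (pverts (F_S p q))"
    by (simp add: inj_on_def)
  moreover have "f ` pverts (F_S p q) \<subseteq> verts G"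
    using s_in w_in V by (auto simp: F_S_def)
  moreover have "f (VS3 i) \<in> X" if "i < q" for i
    using that w_in by simp
  moreover have "f u \<rightarrow>\<^bsub>G\<^esub> f v \<longleftrightarrow> (u, v) \<in> parcs (F_S p q)"
    if "u \<in> pverts (F_S p q)" "v \<in> pverts (F_S p q)"
      and "\<not> (u \<in> range VS3 \<and> v \<in> range VS3)" for u v
  proof -
    have *: "m (s i) \<rightarrow>\<^bsub>G\<^esub> m (s j) \<longleftrightarrow> i \<noteq> j" "m (s i) \<rightarrow>\<^bsub>G\<^esub> s j \<longleftrightarrow> i = j"
      "s i \<rightarrow>\<^bsub>G\<^esub> m (s j) \<longleftrightarrow> i = j" "\<not> s i \<rightarrow>\<^bsub>G\<^esub> s j" if "i < p" "j < p" for i j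
      using that s_in s_eq KK SS m_adj sym by metis+
    \<comment> \<open>Adjacency of \<open>w i\<close> and \<open>w j\<close> is deliberately absent:
      it is the undetermined part.\<close>
    have **: "n (w i) \<rightarrow>\<^bsub>G\<^esub> w j \<longleftrightarrow> i = j" "w i \<rightarrow>\<^bsub>G\<^esub> n (w j) \<longleftrightarrow> i = j"
      "\<not> n (w i) \<rightarrow>\<^bsub>G\<^esub> n (w j)" if "i < q" "j < q" for i j
      using that w_in w_eq SS n_adj sym by metis+
    have ***: "m (s i) \<rightarrow>\<^bsub>G\<^esub> n (w j)" "n (w j) \<rightarrow>\<^bsub>G\<^esub> m (s i)" "\<not> m (s i) \<rightarrow>\<^bsub>G\<^esub> w j"
      "\<not> w j \<rightarrow>\<^bsub>G\<^esub> m (s i)" "\<not> s i \<rightarrow>\<^bsub>G\<^esub> n (w j)" "\<not> n (w j) \<rightarrow>\<^bsub>G\<^esub> s i"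
      "\<not> s i \<rightarrow>\<^bsub>G\<^esub> w j" "\<not> w j \<rightarrow>\<^bsub>G\<^esub> s i" if "i < p" "j < q" for i j
      using that s_in w_in KS no sym by metis+
    show ?thesis
      using verts_cases[OF that(1)] verts_cases[OF that(2)] that(3)
      by (elim disjE exE conjE) (simp_all add: arcs_F_S * ** ***)
  qed
  ultimately show ?thesis by (rule that)
qed

section \<open>Homogeneous subsets from Ramsey's theorem\<close>

text \<open>The partition property in \<open>ramsey_diag\<close> concerns sets of naturals, so
  \<open>W\<close> is numbered and the pairs of indices are coloured, with 1 for adjacent and 0 for
  non-adjacent.\<close>

lemma ramsey_diag_clique_or_stable:
  assumes "symmetric G" and "card W = ramsey_diag q"
  obtains X where "X \<subseteq> W" "card X = q" "clique_in G X \<or> stable_in G X"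
proof -
  have sym: "u \<rightarrow>\<^bsub>G\<^esub> v \<longleftrightarrow> v \<rightarrow>\<^bsub>G\<^esub> u" for u v
    using assms(1) by (meson arcs_ends_symmetric)
  \<comment> \<open>An infinite set has \<open>card\<close> 0, so positivity of
    \<open>ramsey_diag q\<close> excludes it.\<close>
  have "finite W"
    using assms(2) ramsey_diag(1)[of q] card_ge_0_finite by metis
  then obtain w where w: "bij_betw w {..<ramsey_diag q} W"
    using ex_bij_betw_nat_finite assms(2) by (metis atLeast0LessThan)
  define c :: "nat set \<Rightarrow> nat" where
    "c e = (if \<exists>i j. e = {i, j} \<and> w i \<rightarrow>\<^bsub>G\<^esub> w j then 1 else 0)" for e
  \<comment> \<open>The colour is defined on unordered pairs; symmetry of adjacency makes it
    independent of the order in which the pair is written.\<close>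
  have c: "c {i, j} = (if w i \<rightarrow>\<^bsub>G\<^esub> w j then 1 else 0)" for i j
    using sym by (auto simp: c_def doubleton_eq_iff)
  have "c \<in> nsets {..<ramsey_diag q} 2 \<rightarrow> {..<2}"
    by (auto simp: c_def)
  then obtain k H where "k < length [q, q]" and H: "H \<in> nsets {..<ramsey_diag q} ([q, q] ! k)"
    and mono: "c ` nsets H 2 \<subseteq> {k}"
    by (rule partn_lstE[OF ramsey_diag(2)]) simp
  \<comment> \<open>Both entries of \<open>[q, q]\<close> are \<open>q\<close>, so \<open>H\<close>
    has size \<open>q\<close> whichever colour occurs.\<close>
  then have k: "k = 0 \<or> k = 1" by auto
  with H have H: "H \<subseteq> {..<ramsey_diag q}" "card H = q"
    by (auto simp: nsets_def)
  have inj: "inj_on w H"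
    using w H(1) by (meson bij_betw_def inj_on_subset)
  have ck: "c {i, j} = k" if "i \<in> H" "j \<in> H" "i \<noteq> j" for i j
    using mono that by (force simp: image_subset_iff)
  show ?thesis
  proof
    show "w ` H \<subseteq> W" using w H by (auto simp: bij_betw_def)
    show "card (w ` H) = q" using inj H by (simp add: card_image)
    show "clique_in G (w ` H) \<or> stable_in G (w ` H)"
      using k
    proof
      assume "k = 0"
      then have "\<not> w i \<rightarrow>\<^bsub>G\<^esub> w j" if "i \<in> H" "j \<in> H" "i \<noteq> j" for i j
        using ck[OF that] by (simp add: c split: if_splits)
      then show ?thesis by (auto simp: stable_in_def)
    next
      assume "k = 1"
      then have "w i \<rightarrow>\<^bsub>G\<^esub> w j" if "i \<in> H" "j \<in> H" "i \<noteq> j" for i j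
        using ck[OF that] c[of i j] by (metis zero_neq_one)
      then have "clique_in G (w ` H)" unfolding clique_in_def by blast
      then show ?thesis ..
    qed
  qed
qed

section \<open>The forbidden vertex sets in \<open>G\<close>\<close>

text \<open>The embedding settles all adjacencies except those among the images of the
  \<open>VS3\<close> vertices. A homogeneous \<open>X\<close> settles these as well, as in
  \<open>F_K\<close> if it is a clique and as in \<open>F_S\<close> if it is stable.\<close>

lemma no_F_sets:
  assumes "graph G" and "free_of G (F_S p q)" and "free_of G (F_K p q)"
    and V: "K1 \<subseteq> verts G" "S1 \<subseteq> verts G" "S2 \<subseteq> verts G" "W \<subseteq> verts G"
  shows "\<not> F_sets G p (ramsey_diag q) K1 S1 S2 W"
proof
  assume F: "F_sets G p (ramsey_diag q) K1 S1 S2 W"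
  interpret graph G by fact
  have irrefl: "\<not> u \<rightarrow>\<^bsub>G\<^esub> u" for u
    using no_loops by (auto simp: arcs_ends_conv)
  obtain X where X: "X \<subseteq> W" "card X = q" and hom: "clique_in G X \<or> stable_in G X"
    using ramsey_diag_clique_or_stable[OF sym_arcs, of W q] F unfolding F_sets_def by blast
  obtain f where inj: "inj_on f (pverts (F_S p q))" and sub: "f ` pverts (F_S p q) \<subseteq> verts G"
    and fX: "\<And>i. i < q \<Longrightarrow> f (VS3 i) \<in> X"
    and adj: "\<And>u v. u \<in> pverts (F_S p q) \<Longrightarrow> v \<in> pverts (F_S p q) \<Longrightarrow>
      \<not> (u \<in> range VS3 \<and> v \<in> range VS3) \<Longrightarrow> f u \<rightarrow>\<^bsub>G\<^esub> f v \<longleftrightarrow> (u, v) \<in> parcs (F_S p q)"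
    using F_sets_embedding[OF \<open>graph G\<close> F V X] by blast
  have S3: "VS3 i \<in> pverts (F_S p q) \<longleftrightarrow> i < q" for i
    by (auto simp: F_S_def)
  have wfS: "parcs (F_S p q) \<subseteq> pverts (F_S p q) \<times> pverts (F_S p q)"
    by (auto simp: F_S_def sym_closure_def)
  from hom show False
  proof
    assume X: "clique_in G X"
    have "f u \<rightarrow>\<^bsub>G\<^esub> f v \<longleftrightarrow> (u, v) \<in> parcs (F_K p q)"
      if uv: "u \<in> pverts (F_S p q)" "v \<in> pverts (F_S p q)" for u v
    proof (cases "u \<in> range VS3 \<and> v \<in> range VS3")
      case True
      then obtain i j where ij: "u = VS3 i" "v = VS3 j" "i < q" "j < q"
        using uv S3 by auto
      \<comment> \<open>\<open>clique_in\<close> speaks of distinct vertices only: injectivity of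
        \<open>f\<close> supplies distinctness for \<open>i \<noteq> j\<close>, and the absence of
        loops handles \<open>i = j\<close>.\<close>
      then have "f u \<rightarrow>\<^bsub>G\<^esub> f v \<longleftrightarrow> i \<noteq> j"
        using X fX[OF ij(3)] fX[OF ij(4)] irrefl inj_on_eq_iff[OF inj uv]
        by (auto simp: clique_in_def)
      with ij show ?thesis by (simp add: arcs_F_K arcs_F_S)
    next
      case False
      with uv show ?thesis
        by (auto simp: adj arcs_F_K split: fvert.splits)
    qed
    moreover have "pverts (F_K p q) = pverts (F_S p q)"
      by (simp add: F_K_def)
    moreover have "parcs (F_K p q) \<subseteq> pverts (F_S p q) \<times> pverts (F_S p q)"
      using wfS S3 by (auto simp: F_K_def)
    ultimately have "\<not> free_of G (F_K p q)"
      using inj sub by (intro not_free_of_if_embedding[OF \<open>graph G\<close>]) auto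
    with assms show False by simp
  next
    assume X: "stable_in G X"
    have "f u \<rightarrow>\<^bsub>G\<^esub> f v \<longleftrightarrow> (u, v) \<in> parcs (F_S p q)"
      if uv: "u \<in> pverts (F_S p q)" "v \<in> pverts (F_S p q)" for u v
    proof (cases "u \<in> range VS3 \<and> v \<in> range VS3")
      case True
      then obtain i j where ij: "u = VS3 i" "v = VS3 j" "i < q" "j < q"
        using uv S3 by auto
      then have "\<not> f u \<rightarrow>\<^bsub>G\<^esub> f v"
        using X fX[OF ij(3)] fX[OF ij(4)] irrefl unfolding stable_in_def by metis
      with ij show ?thesis by (simp add: arcs_F_S)
    next
      case False
      with uv show ?thesis by (rule adj)
    qed
    then have "\<not> free_of G (F_S p q)"
      using inj sub wfS by (intro not_free_of_if_embedding[OF \<open>graph G\<close>]) auto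
    with assms show False by simp
  qed
qed

section \<open>Transport of the structure along an induced copy\<close>

lemma matched_image:
  assumes inj: "inj_on g A" and XY: "X \<subseteq> A" "Y \<subseteq> A" and "matched H X Y"
    and adj: "\<And>u v. u \<in> A \<Longrightarrow> v \<in> A \<Longrightarrow> g u \<rightarrow>\<^bsub>G\<^esub> g v \<longleftrightarrow> u \<rightarrow>\<^bsub>H\<^esub> v"
  shows "matched G (g ` X) (g ` Y)"
proof -
  \<comment> \<open>Stated for arbitrary \<open>X\<close> and \<open>Y\<close>, since
    \<open>matched\<close> needs it once in each direction. Uniqueness survives because
    \<open>g\<close> also reflects adjacency.\<close>
  have "\<exists>!y. y \<in> g ` Y \<and> g x \<rightarrow>\<^bsub>G\<^esub> y"
    if "x \<in> X" "X \<subseteq> A" "Y \<subseteq> A" and ex1: "\<exists>!y. y \<in> Y \<and> x \<rightarrow>\<^bsub>H\<^esub> y" for X Y x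
  proof -
    obtain y where y: "y \<in> Y" "x \<rightarrow>\<^bsub>H\<^esub> y" and unique: "\<And>z. z \<in> Y \<Longrightarrow> x \<rightarrow>\<^bsub>H\<^esub> z \<Longrightarrow> z = y"
      using ex1 by auto
    show ?thesis
    proof (rule ex1I[of _ "g y"])
      show "g y \<in> g ` Y \<and> g x \<rightarrow>\<^bsub>G\<^esub> g y" using y that(1-3) by (auto simp: adj subset_iff)
      show "z = g y" if "z \<in> g ` Y \<and> g x \<rightarrow>\<^bsub>G\<^esub> z" for z
        using that unique \<open>x \<in> X\<close> \<open>X \<subseteq> A\<close> \<open>Y \<subseteq> A\<close> by (auto simp: adj subset_iff)
    qed
  qed
  with XY assms(4) show ?thesis by (auto simp: matched_def)
qed

text \<open>All conditions concern disjointness, cardinality or adjacency within \<open>A\<close>,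
  and an injective map that preserves and reflects adjacency on \<open>A\<close> respects each of
  these.\<close>

lemma F_sets_image:
  assumes F: "F_sets H a b K1 S1 S2 W" and inj: "inj_on g A"
    and sub: "K1 \<subseteq> A" "S1 \<subseteq> A" "S2 \<subseteq> A" "W \<subseteq> A"
    and adj: "\<And>u v. u \<in> A \<Longrightarrow> v \<in> A \<Longrightarrow> g u \<rightarrow>\<^bsub>G\<^esub> g v \<longleftrightarrow> u \<rightarrow>\<^bsub>H\<^esub> v"
  shows "F_sets G a b (g ` K1) (g ` S1) (g ` S2) (g ` W)"
proof -
  note F = F[unfolded F_sets_def]
  have disj: "g ` X \<inter> g ` Y = {}" if "X \<inter> Y = {}" "X \<subseteq> A" "Y \<subseteq> A" for X Y
    using that inj_on_image_Int[OF inj] by (metis image_empty)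
  have card: "card (g ` X) = card X" if "X \<subseteq> A" for X
    using that inj by (meson card_image inj_on_subset)
  have clique: "clique_in G (g ` K1)"
    using F sub by (auto simp: clique_in_def adj subset_iff)
  have stable: "stable_in G (g ` X)" if "stable_in H X" "X \<subseteq> A" for X
    using that by (auto simp: stable_in_def adj subset_iff)
  have complete: "complete_to G (g ` K1) (g ` S2)"
    using F sub by (auto simp: complete_to_def adj subset_iff)
  have matched: "matched G (g ` X) (g ` Y)" if "matched H X Y" "X \<subseteq> A" "Y \<subseteq> A" for X Y
    using matched_image[OF inj that(2,3,1) adj] .
  \<comment> \<open>An edge between images is pulled back to \<open>H\<close>, located in one of the
    permitted products there, and pushed forward again.\<close>
  have rest: "(g u, g v) \<in> sym_closure (g ` K1 \<times> g ` K1 \<union> g ` K1 \<times> g ` S1 \<union> g ` S2 \<times> g ` W \<union>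
      g ` K1 \<times> g ` S2 \<union> g ` W \<times> g ` W)"
    if uv: "u \<in> K1 \<union> S1 \<union> S2 \<union> W" "v \<in> K1 \<union> S1 \<union> S2 \<union> W" and "g u \<rightarrow>\<^bsub>G\<^esub> g v" for u v
  proof -
    have "u \<in> A" "v \<in> A" using uv sub by auto
    then have "u \<rightarrow>\<^bsub>H\<^esub> v" using that adj by simp
    then have "(u, v) \<in> sym_closure (K1 \<times> K1 \<union> K1 \<times> S1 \<union> S2 \<times> W \<union> K1 \<times> S2 \<union> W \<times> W)"
      using F uv by blast
    then show ?thesis
      unfolding sym_closure_def Un_iff converse_iff mem_Sigma_iff by (elim disjE conjE) simp_all
  qed
  have "\<forall>u \<in> g ` K1 \<union> g ` S1 \<union> g ` S2 \<union> g ` W. \<forall>v \<in> g ` K1 \<union> g ` S1 \<union> g ` S2 \<union> g ` W. u \<rightarrow>\<^bsub>G\<^esub> v \<longrightarrow>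
      (u, v) \<in> sym_closure (g ` K1 \<times> g ` K1 \<union> g ` K1 \<times> g ` S1 \<union> g ` S2 \<times> g ` W \<union>
        g ` K1 \<times> g ` S2 \<union> g ` W \<times> g ` W)"
    unfolding image_Un[symmetric] using rest by (intro ballI impI) blast
  with F sub show ?thesis
    unfolding F_sets_def by (intro conjI) (simp_all add: disj card clique stable complete matched)
qed

text \<open>Inverting the vertex map of the isomorphism gives \<open>g\<close>. Being induced,
  \<open>H'\<close> has the adjacency of \<open>G\<close> on its vertices, and
  \<open>app_iso\<close> merely renames them.\<close>

lemma induced_copy_embedding:
  assumes "graph G" and "induced_subgraph H' G" and "digraph_iso H' H"
  obtains g where "inj_on g (verts H)" and "g ` verts H \<subseteq> verts G"
    and "\<And>u v. u \<in> verts H \<Longrightarrow> v \<in> verts H \<Longrightarrow> g u \<rightarrow>\<^bsub>G\<^esub> g v \<longleftrightarrow> u \<rightarrow>\<^bsub>H\<^esub> v"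
proof -
  interpret graph G by fact
  obtain h where h: "pre_digraph.digraph_isomorphism H' h" and H: "H = app_iso h H'"
    using assms(3) by (auto simp: digraph_iso_def)
  interpret H': wf_digraph H'
    using h by (simp add: pre_digraph.digraph_isomorphism_def)
  have inj: "inj_on (iso_verts h) (verts H')"
    using h by (rule pre_digraph.digraph_isomorphism_inj_on_verts)
  define g where "g = the_inv_into (verts H') (iso_verts h)"
  have g: "g (iso_verts h u) = u" if "u \<in> verts H'" for u
    using that inj by (simp add: g_def the_inv_into_f_f)
  have verts: "verts H = iso_verts h ` verts H'" by (simp add: H)
  have ind: "u \<rightarrow>\<^bsub>G\<^esub> v \<longleftrightarrow> u \<rightarrow>\<^bsub>H'\<^esub> v" if "u \<in> verts H'" "v \<in> verts H'" for u v
  proof -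
    have "arcs H' = {e \<in> arcs G. tail G e \<in> verts H' \<and> head G e \<in> verts H'}"
      using assms(2) unfolding induced_subgraph_def by blast
    moreover have "tail H' = tail G" "head H' = head G"
      using assms(2) unfolding induced_subgraph_def subgraph_def compatible_def by metis+
    ultimately show ?thesis
      using that by (auto simp: arcs_ends_conv)
  qed
  have "u \<rightarrow>\<^bsub>H'\<^esub> v \<longleftrightarrow> iso_verts h u \<rightarrow>\<^bsub>H\<^esub> iso_verts h v" if "u \<in> verts H'" "v \<in> verts H'" for u v
  proof
    assume "u \<rightarrow>\<^bsub>H'\<^esub> v"
    then show "iso_verts h u \<rightarrow>\<^bsub>H\<^esub> iso_verts h v"
      by (force simp: H H'.arcs_ends_app_iso_eq[OF h])
  next
    assume "iso_verts h u \<rightarrow>\<^bsub>H\<^esub> iso_verts h v"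
    \<comment> \<open>An adjacency in \<open>H\<close> comes from some adjacent \<open>x\<close> and
      \<open>y\<close> of \<open>H'\<close>; injectivity on vertices identifies them with
      \<open>u\<close> and \<open>v\<close>.\<close>
    then obtain x y where "x \<rightarrow>\<^bsub>H'\<^esub> y" "iso_verts h u = iso_verts h x" "iso_verts h v = iso_verts h y"
      by (auto simp: H H'.arcs_ends_app_iso_eq[OF h])
    with that show "u \<rightarrow>\<^bsub>H'\<^esub> v"
      using inj by (metis H'.adj_in_verts inj_on_eq_iff)
  qed
  with ind have "g u \<rightarrow>\<^bsub>G\<^esub> g v \<longleftrightarrow> u \<rightarrow>\<^bsub>H\<^esub> v" if "u \<in> verts H" "v \<in> verts H" for u v
    using that by (auto simp: verts g)
  moreover have "inj_on g (verts H)"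
    by (auto simp: verts inj_on_def g)
  moreover have "g ` verts H \<subseteq> verts G"
    using assms(2) by (auto simp: verts g induced_subgraph_def subgraph_def)
  ultimately show ?thesis by (rule that[rotated 2])
qed

theorem theorem2p2:
  fixes p q :: nat and G :: "('a,'b) pre_digraph"
  assumes "p > 0" and "q > 0"
    and "graph G"
    and "free_of G (F_S p q)" and "free_of G (F_K p q)"
  shows "(\<forall>H :: ('c,'d) pre_digraph. F_form p (ramsey_diag q) H \<longrightarrow> free_of G H) \<and>
    \<not> (\<exists>K1 S1 S2 W. K1 \<subseteq> verts G \<and> S1 \<subseteq> verts G \<and> S2 \<subseteq> verts G \<and> W \<subseteq> verts G \<and>
         F_sets G p (ramsey_diag q) K1 S1 S2 W)"
proof (intro conjI allI impI)
  show "\<not> (\<exists>K1 S1 S2 W. K1 \<subseteq> verts G \<and> S1 \<subseteq> verts G \<and> S2 \<subseteq> verts G \<and> W \<subseteq> verts G \<and>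
         F_sets G p (ramsey_diag q) K1 S1 S2 W)"
    using no_F_sets[OF assms(3-5)] by blast
  fix H :: "('c,'d) pre_digraph"
  assume "F_form p (ramsey_diag q) H"
  then obtain K1 S1 S2 W where V: "verts H = K1 \<union> S1 \<union> S2 \<union> W"
    and F: "F_sets H p (ramsey_diag q) K1 S1 S2 W"
    by (auto simp: F_form_def)
  show "free_of G H"
    unfolding free_of_def
  proof
    assume "\<exists>H'. induced_subgraph H' G \<and> digraph_iso H' H"
    then obtain H' where "induced_subgraph H' G" "digraph_iso H' H" by blast
    then obtain g where g: "inj_on g (verts H)" "g ` verts H \<subseteq> verts G"
      "\<And>u v. u \<in> verts H \<Longrightarrow> v \<in> verts H \<Longrightarrow> g u \<rightarrow>\<^bsub>G\<^esub> g v \<longleftrightarrow> u \<rightarrow>\<^bsub>H\<^esub> v"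
      using induced_copy_embedding[OF \<open>graph G\<close>] by blast
    \<comment> \<open>\<open>H\<close> may have other vertex and arc types than \<open>G\<close>, so
      its four sets are carried into \<open>G\<close>, where \<open>no_F_sets\<close>
      applies.\<close>
    have "F_sets G p (ramsey_diag q) (g ` K1) (g ` S1) (g ` S2) (g ` W)"
      by (rule F_sets_image[OF F g(1)]) (use V g(3) in auto)
    moreover have "\<not> F_sets G p (ramsey_diag q) (g ` K1) (g ` S1) (g ` S2) (g ` W)"
      by (rule no_F_sets[OF assms(3-5)]) (use V g(2) in auto)
    ultimately show False by contradiction
  qed
qed

end
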